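(* Let $Q(z)=\sum_{m\ge1}Q_m\frac{z^m}{m!}$ be defined implicitly by \[z=\int_0^{Q(z)}\frac{dt}{2e^t-t-1}.\] For $m\ge1$ let $T_m$ be the number of unordered unilabelled-bilabelled increasing trees with label set $\{1,\dots,m\}$ and $T(z)=\sum_{m\ge1}T_m\frac{z^m}{m!}$. Then \[T'(z)=Q(z)+Q'(z),\] hence $T_m=Q_m+Q_{m-1}$, where the numbers $Q_m$ satisfy \[Q_{m+2}=\sum_{k=0}^m\binom mk(Q_k+Q_{k+1})Q_{m-k+1}\quad(m\ge0),\qquad Q_0=0,\ Q_1=1.\]
   Context: An unordered unilabelled-bilabelled increasing tree with label set $\{1,\dots,m\}$ is a rooted non-plane (unordered) tree in which each node carries a set of one or two labels, these sets partitioning $\{1,\dots,m\}$, such that every label of a child is larger than every label of its parent. Equivalently, $T_m$ is the total weight of such labelled ordered trees with degree-weights $\varphi_j=1/j!$, i.e. degree-weight generating function $e^t$. *)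

theory Defs
  imports "HOL-Library.Multiset" "HOL-Computational_Algebra.Formal_Power_Series"
begin

text \<open>Unordered rooted trees: the children of a node form a multiset, and every node carries a
  set of labels.\<close>

datatype ltree = Node (node_labels: "nat set") (children: "ltree multiset")

primrec all_labels :: "ltree \<Rightarrow> nat multiset" where
  "all_labels (Node L ts) = mset_set L + sum_mset (image_mset all_labels ts)"

inductive uni_bilabelled :: "ltree \<Rightarrow> bool" where
  "card L = 1 \<or> card L = 2 \<Longrightarrow> (\<And>t. t \<in># ts \<Longrightarrow> uni_bilabelled t)
    \<Longrightarrow> uni_bilabelled (Node L ts)"

inductive increasing :: "ltree \<Rightarrow> bool" where
  "(\<And>t. t \<in># ts \<Longrightarrow> \<forall>a\<in>L. \<forall>b\<in>node_labels t. a < b)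
    \<Longrightarrow> (\<And>t. t \<in># ts \<Longrightarrow> increasing t)
    \<Longrightarrow> increasing (Node L ts)"

text \<open>Since the label sets are nonempty and finite, the condition on \<^const>\<open>all_labels\<close>, i.e. every
  label of \<open>{1..m}\<close> occurs in exactly one node and no other label occurs, says that the label sets
  of the nodes form a partition of \<open>{1..m}\<close>.\<close>

definition ub_increasing_trees :: "nat \<Rightarrow> ltree set" where
  "ub_increasing_trees m =
    {t. uni_bilabelled t \<and> all_labels t = mset_set {1..m} \<and> increasing t}"

definition num_trees :: "nat \<Rightarrow> nat" where
  "num_trees m = card (ub_increasing_trees m)"

definition tree_egf :: "real fps" where
  "tree_egf = Abs_fps (\<lambda>m. if m = 0 then 0 else real (num_trees m) / fact m)"

definition egf_coeff :: "real fps \<Rightarrow> nat \<Rightarrow> real" where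
  "egf_coeff F m = fact m * fps_nth F m"

text \<open>The equation \<open>z = \<integral>\<^sub>0\<^bsup>Q(z)\<^esup> dt / (2 e\<^sup>t - t - 1)\<close> for a power series \<open>Q\<close> without constant
  term: \<^const>\<open>fps_integral0\<close> is the antiderivative with constant term 0, so substituting \<open>Q\<close> into it
  is the integral from 0 to \<open>Q(z)\<close>. The integrand is a power series because its denominator has
  constant term 1.\<close>

definition implicit_integral_eq :: "real fps \<Rightarrow> bool" where
  "implicit_integral_eq Q \<longleftrightarrow>
    fps_X = fps_compose (fps_integral0 (inverse (2 * fps_exp 1 - fps_X - 1))) Q"

lemma implicit_integral_eq_ex1: "\<exists>!Q. fps_nth Q 0 = 0 \<and> implicit_integral_eq Q"
proof -
  define A :: "real fps" where "A = fps_integral0 (inverse (2 * fps_exp 1 - fps_X - 1))"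
  have A0: "fps_nth A 0 = 0" and A1: "fps_nth A 1 \<noteq> 0"
    by (simp_all add: A_def fps_integral_def)
  show ?thesis
  proof (rule ex1I[of _ "fps_inv A"])
    show "fps_nth (fps_inv A) 0 = 0 \<and> implicit_integral_eq (fps_inv A)"
      using fps_inv_right[OF A0 A1] by (simp add: implicit_integral_eq_def A_def fps_inv_def)
  next
    fix Q assume Q: "fps_nth Q 0 = 0 \<and> implicit_integral_eq Q"
    have "fps_compose (fps_inv A) (fps_compose A Q) = fps_compose (fps_compose (fps_inv A) A) Q"
      using Q A0 by (simp add: fps_compose_assoc)
    then show "Q = fps_inv A"
      using Q fps_inv[OF A0 A1]
      by (simp add: implicit_integral_eq_def flip: A_def)
  qed
qed

end

theory Submission imports Defs begin

text \<open>A root block \<open>{1, j}\<close> forces \<open>j = 2\<close>, because every other label lies below the root. So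
  deleting the root of a tree on \<open>m\<close> labels leaves an arbitrary forest on \<open>m - 1\<close> or \<open>m - 2\<close>
  labels, and splitting off the tree that contains a fixed label expresses the number of forests
  through the numbers of trees and of smaller forests. On the other side, \<open>Q' = 2 e\<^sup>Q - Q - 1\<close> gives
  \<open>Q'' = (2 e\<^sup>Q - 1) Q' = (Q + Q') Q'\<close>, which is the same recurrence: \<open>Q'\<close> is the exponential
  generating function of the forests, i.e. \<open>Q\<^bsub>m+1\<^esub>\<close> counts the forests on \<open>m\<close> labels.\<close>

section \<open>Trees and forests over an arbitrary label set\<close>

text \<open>Label sets other than \<open>{1..m}\<close> are allowed because deleting a root and
  splitting a forest leave such sets; this avoids any relabelling.\<close>

definition trees_on :: "nat set \<Rightarrow> ltree set" where
  "trees_on A = {t. uni_bilabelled t \<and> all_labels t = mset_set A \<and> increasing t}"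

text \<open>These are the possible collections of subtrees below a root. No tree is repeated in one,
  since every tree has a label and no label occurs twice.\<close>

definition forests_on :: "nat set \<Rightarrow> ltree multiset set" where
  "forests_on A = {ts. (\<forall>t\<in>#ts. uni_bilabelled t \<and> increasing t) \<and>
     sum_mset (image_mset all_labels ts) = mset_set A}"

lemma uni_bilabelled_Node_iff:
  "uni_bilabelled (Node L ts) \<longleftrightarrow> (card L = 1 \<or> card L = 2) \<and> (\<forall>t\<in>#ts. uni_bilabelled t)"
  by (subst uni_bilabelled.simps) auto

lemma increasing_Node_iff:
  "increasing (Node L ts) \<longleftrightarrow>
     (\<forall>t\<in>#ts. (\<forall>a\<in>L. \<forall>b\<in>node_labels t. a < b) \<and> increasing t)"
  by (subst increasing.simps) auto

lemma uni_bilabelled_finite_labels: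
  assumes "uni_bilabelled t" shows "finite (node_labels t)" "node_labels t \<noteq> {}"
proof -
  have "card (node_labels t) \<noteq> 0"
    using assms by (cases t) (auto simp: uni_bilabelled_Node_iff)
  then show "finite (node_labels t)" "node_labels t \<noteq> {}"
    by (auto intro: card_ge_0_finite)
qed

lemma node_labels_subset_all_labels:
  "uni_bilabelled t \<Longrightarrow> b \<in> node_labels t \<Longrightarrow> b \<in># all_labels t"
  using uni_bilabelled_finite_labels[of t] by (cases t) auto

text \<open>\<open>increasing\<close> compares only parent and child. The bound travels down the
  tree through some label of each node on the way, which exists because label sets are nonempty;
  hence \<open>a\<close> varies in the induction.\<close>

lemma less_root_imp_less_all_labels:
  assumes "uni_bilabelled t" "increasing t" "\<forall>b\<in>node_labels t. a < b" "x \<in># all_labels t"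
  shows "a < x"
  using assms
proof (induction t arbitrary: a rule: ltree.induct)
  case (Node L ts)
  have L: "finite L" "L \<noteq> {}"
    using uni_bilabelled_finite_labels[OF Node.prems(1)] by auto
  show ?case
  proof (cases "x \<in> L")
    case True
    then show ?thesis using Node.prems(3) by simp
  next
    case False
    then obtain t where t: "t \<in># ts" "x \<in># all_labels t"
      using Node.prems(4) L by auto
    obtain l where l: "l \<in> L" using L by auto
    have "l < x"
      using Node.IH[of t l] t l Node.prems(1,2)
      by (auto simp: uni_bilabelled_Node_iff increasing_Node_iff)
    then show ?thesis using Node.prems(3) l by fastforce
  qed
qed

lemma forests_on_empty: "forests_on {} = {{#}}"
proof -
  have "ts = {#}" if "ts \<in> forests_on {}" for ts
  proof (rule ccontr)
    assume "ts \<noteq> {#}"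
    then obtain t where t: "t \<in># ts" by auto
    with that have "uni_bilabelled t" by (auto simp: forests_on_def)
    then obtain b where "b \<in># all_labels t"
      using uni_bilabelled_finite_labels[of t] node_labels_subset_all_labels[of t] by blast
    with t that show False by (auto simp: forests_on_def)
  qed
  then show ?thesis by (auto simp: forests_on_def)
qed

section \<open>Deleting the root of a tree\<close>

text \<open>By transitivity the order condition at the root compares \<open>L\<close> with all of
  \<open>A - L\<close>. In this form it does not mention \<open>ts\<close>, so the root block and
  the forest below it can be chosen separately.\<close>

lemma Node_mem_trees_on_iff:
  assumes "finite A"
  shows "Node L ts \<in> trees_on A \<longleftrightarrow>
    L \<subseteq> A \<and> (card L = 1 \<or> card L = 2) \<and> (\<forall>a\<in>L. \<forall>b\<in>A - L. a < b) \<and> ts \<in> forests_on (A - L)"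
    (is "?l \<longleftrightarrow> ?r")
proof
  assume l: ?l
  have ub: "uni_bilabelled (Node L ts)" and inc: "increasing (Node L ts)"
    and lab: "mset_set L + sum_mset (image_mset all_labels ts) = mset_set A"
    using l by (auto simp: trees_on_def)
  \<comment> \<open>For infinite \<open>L\<close> the multiset \<open>mset_set L\<close> would be
    empty and would not show the elements of \<open>L\<close>.\<close>
  have finL: "finite L" using uni_bilabelled_finite_labels[OF ub] by simp
  have LA: "L \<subseteq> A"
  proof
    fix x assume "x \<in> L"
    then have "x \<in># mset_set A" using finL by (simp flip: lab)
    then show "x \<in> A" using assms by simp
  qed
  have rest: "sum_mset (image_mset all_labels ts) = mset_set (A - L)"
    using lab mset_set_Diff[OF assms LA] by (metis add_diff_cancel_left')
  have "a < b" if "a \<in> L" "b \<in> A - L" for a b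
  proof -
    have "b \<in># sum_mset (image_mset all_labels ts)" using rest that assms by simp
    then obtain t where "t \<in># ts" "b \<in># all_labels t" by auto
    then show ?thesis
      using less_root_imp_less_all_labels[of t a b] that ub inc
      by (auto simp: uni_bilabelled_Node_iff increasing_Node_iff)
  qed
  then show ?r
    using LA ub inc rest
    by (auto simp: uni_bilabelled_Node_iff increasing_Node_iff forests_on_def)
next
  assume r: ?r
  have rest: "sum_mset (image_mset all_labels ts) = mset_set (A - L)"
    and ts: "\<forall>t\<in>#ts. uni_bilabelled t \<and> increasing t"
    using r by (auto simp: forests_on_def)
  have "mset_set L + mset_set (A - L) = mset_set A"
    using r assms by (metis mset_set_Diff subset_imp_msubset_mset_set subset_mset.add_diff_inverse)
  moreover have "a < b" if "t \<in># ts" "a \<in> L" "b \<in> node_labels t" for t a b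
  proof -
    have "b \<in># all_labels t" using node_labels_subset_all_labels ts that by blast
    then have "b \<in># sum_mset (image_mset all_labels ts)" using that by auto
    then show ?thesis using r rest assms that by auto
  qed
  ultimately show ?l
    using r ts rest by (auto simp: trees_on_def uni_bilabelled_Node_iff increasing_Node_iff)
qed

lemma trees_on_singleton: "trees_on {a} = Node {a} ` forests_on {}"
proof -
  have "t \<in> trees_on {a} \<longleftrightarrow> t \<in> Node {a} ` forests_on {}" for t
    by (cases t) (auto simp: Node_mem_trees_on_iff subset_singleton_iff)
  then show ?thesis by blast
qed

text \<open>Here \<open>a\<close> and \<open>b\<close> are the two smallest labels. They determine
  the only two possible root blocks, and each leaves an unrestricted forest.\<close>

lemma trees_on_insert2:
  assumes "finite A" "a < b" "\<And>x. x \<in> A \<Longrightarrow> b < x"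
  shows "trees_on (insert a (insert b A)) =
    Node {a} ` forests_on (insert b A) \<union> Node {a, b} ` forests_on A"
proof -
  let ?A = "insert a (insert b A)"
  have nin: "a \<notin> A" "b \<notin> A" using assms by force+
  have diff: "?A - {a} = insert b A" "?A - {a, b} = A" using nin assms(2) by auto
  have blocks: "L \<subseteq> ?A \<and> (card L = 1 \<or> card L = 2) \<and> (\<forall>x\<in>L. \<forall>y\<in>?A - L. x < y)
      \<longleftrightarrow> L = {a} \<or> L = {a, b}" (is "?l \<longleftrightarrow> ?r") for L
  proof
    assume l: ?l
    then have "finite L" "L \<noteq> {}" by (auto intro: card_ge_0_finite)
    have aL: "a \<in> L"
    proof (rule ccontr)
      assume "a \<notin> L"
      moreover obtain x where "x \<in> L" using \<open>L \<noteq> {}\<close> by auto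
      ultimately have "x < a" "x \<in> insert b A" using l by auto
      then show False using assms(2,3) by force
    qed
    show ?r
    proof (cases "card L = 1")
      case True
      then show ?thesis using aL by (auto simp: card_1_singleton_iff)
    next
      case False
      then obtain c where c: "L = {a, c}" "c \<noteq> a"
        using l aL by (auto simp: card_2_iff)
      \<comment> \<open>Otherwise \<open>b\<close> lies below the root, so \<open>c < b\<close>,
        although \<open>b\<close> is smaller than every element of \<open>A\<close>.\<close>
      have "c = b"
      proof (rule ccontr)
        assume "c \<noteq> b"
        then have "c < b" "c \<in> A" using l c assms(2) by auto
        then show False using assms(3) by force
      qed
      then show ?thesis using c by simp
    qed
  next
    assume ?r
    moreover have "a < x" if "x \<in> A" for x using assms(2) assms(3)[OF that] by simp
    ultimately show ?l using assms by auto
  qed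
  have "t \<in> trees_on ?A \<longleftrightarrow>
      t \<in> Node {a} ` forests_on (insert b A) \<union> Node {a, b} ` forests_on A" for t
  proof (cases t)
    case (Node L ts)
    have "t \<in> trees_on ?A \<longleftrightarrow> (L = {a} \<or> L = {a, b}) \<and> ts \<in> forests_on (?A - L)"
      using assms(1) blocks[of L] Node Node_mem_trees_on_iff[of ?A L ts] by blast
    also have "\<dots> \<longleftrightarrow>
        L = {a} \<and> ts \<in> forests_on (insert b A) \<or> L = {a, b} \<and> ts \<in> forests_on A"
      using diff by metis
    also have "\<dots> \<longleftrightarrow> t \<in> Node {a} ` forests_on (insert b A) \<union> Node {a, b} ` forests_on A"
      using Node by auto
    finally show ?thesis .
  qed
  then show ?thesis by blast
qed

section \<open>Splitting off the tree that carries a fixed label\<close>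

text \<open>Exactly one tree of the forest carries \<open>a\<close>, so \<open>a\<close> singles it
  out although the trees are unordered. \<open>B\<close> is the set of its other labels.\<close>

lemma forests_on_bij_betw:
  assumes "finite A" "a \<notin> A"
  shows "bij_betw (\<lambda>(B, t, ts). add_mset t ts)
    (SIGMA B:Pow A. trees_on (insert a B) \<times> forests_on (A - B)) (forests_on (insert a A))"
proof (rule bij_betw_imageI)
  let ?S = "SIGMA B:Pow A. trees_on (insert a B) \<times> forests_on (A - B)"
  have fin: "finite B" if "B \<subseteq> A" for B using that assms finite_subset by blast
  show "inj_on (\<lambda>(B, t, ts). add_mset t ts) ?S"
  proof (rule inj_onI)
    fix p p' assume "p \<in> ?S" "p' \<in> ?S"
      and "(\<lambda>(B, t, ts). add_mset t ts) p = (\<lambda>(B, t, ts). add_mset t ts) p'"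
    moreover obtain B t ts B' t' ts' where pp: "p = (B, t, ts)" "p' = (B', t', ts')"
      by (metis prod_cases3)
    ultimately have eq: "add_mset t ts = add_mset t' ts'"
      and B: "B \<subseteq> A" "t \<in> trees_on (insert a B)" "ts \<in> forests_on (A - B)"
      and B': "B' \<subseteq> A" "t' \<in> trees_on (insert a B')" "ts' \<in> forests_on (A - B')"
      by auto
    have t: "all_labels t = mset_set (insert a B)" "all_labels t' = mset_set (insert a B')"
      using B B' by (auto simp: trees_on_def)
    \<comment> \<open>If they differed, \<open>t\<close> would lie in \<open>ts'\<close>, whose
      labels avoid \<open>a\<close>.\<close>
    have "t = t'"
    proof (rule ccontr)
      assume "t \<noteq> t'"
      then have "t \<in># ts'" using eq by (metis insert_noteq_member)
      moreover have "a \<in># all_labels t" using t fin[OF B(1)] by simp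
      ultimately have "a \<in># sum_mset (image_mset all_labels ts')" by auto
      moreover have "sum_mset (image_mset all_labels ts') = mset_set (A - B')"
        using B'(3) by (simp add: forests_on_def)
      ultimately have "a \<in># mset_set (A - B')" by metis
      then show False using assms by simp
    qed
    moreover have "insert a B = insert a B'"
      using t fin[OF B(1)] fin[OF B'(1)] \<open>t = t'\<close> by (metis finite_insert finite_set_mset_mset_set)
    moreover have "a \<notin> B" "a \<notin> B'" using B B' assms by auto
    ultimately show "p = p'" using eq pp by auto
  qed
  show "(\<lambda>(B, t, ts). add_mset t ts) ` ?S = forests_on (insert a A)"
  proof (intro equalityI subsetI)
    fix us assume "us \<in> (\<lambda>(B, t, ts). add_mset t ts) ` ?S"
    then obtain B t ts where us: "us = add_mset t ts" and B: "B \<subseteq> A"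
      "t \<in> trees_on (insert a B)" "ts \<in> forests_on (A - B)" by auto
    have "mset_set (insert a B) + mset_set (A - B) = mset_set (insert a B \<union> (A - B))"
      using assms fin[OF B(1)] by (intro mset_set_Union[symmetric]) auto
    also have "insert a B \<union> (A - B) = insert a A" using B by auto
    finally show "us \<in> forests_on (insert a A)"
      using B us by (auto simp: forests_on_def trees_on_def)
  next
    fix us assume us: "us \<in> forests_on (insert a A)"
    then have sum: "sum_mset (image_mset all_labels us) = mset_set (insert a A)"
      by (simp add: forests_on_def)
    have "a \<in># sum_mset (image_mset all_labels us)" using sum assms by simp
    then obtain t where t: "t \<in># us" "a \<in># all_labels t" by auto
    then obtain ts where ts: "us = add_mset t ts" by (meson mset_add)
    define B where "B = set_mset (all_labels t) - {a}"
    have le: "all_labels t \<subseteq># mset_set (insert a A)"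
      using sum ts by (metis image_mset_add_mset mset_subset_eq_add_left sum_mset.add_mset)
    have BA: "B \<subseteq> A" using set_mset_mono[OF le] assms by (auto simp: B_def)
    have ins: "insert a B = set_mset (all_labels t)" using t by (auto simp: B_def)
    \<comment> \<open>A submultiset of a multiset with multiplicities at most 1 is determined by its
      support.\<close>
    have "all_labels t = mset_set (set_mset (all_labels t))"
    proof (rule multiset_eqI)
      fix x
      have "count (all_labels t) x \<le> count (mset_set (insert a A)) x"
        using le by (rule mset_subset_eq_count)
      also have "\<dots> \<le> 1" by (simp add: count_mset_set')
      finally show "count (all_labels t) x = count (mset_set (set_mset (all_labels t))) x"
        by (cases "x \<in># all_labels t")
          (auto simp: count_mset_set' count_eq_zero_iff Suc_le_eq le_antisym)
    qed
    then have lab: "all_labels t = mset_set (insert a B)" using ins by simp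
    have "mset_set (insert a A) = mset_set (insert a B) + mset_set (A - B)"
    proof -
      have "insert a B \<union> (A - B) = insert a A" using BA by auto
      moreover have "mset_set (insert a B \<union> (A - B)) = mset_set (insert a B) + mset_set (A - B)"
        using assms fin[OF BA] by (intro mset_set_Union) auto
      ultimately show ?thesis by simp
    qed
    then have "sum_mset (image_mset all_labels ts) = mset_set (A - B)"
      using sum ts lab by simp
    then have "ts \<in> forests_on (A - B)" "t \<in> trees_on (insert a B)"
      using us ts lab by (auto simp: forests_on_def trees_on_def)
    then show "us \<in> (\<lambda>(B, t, ts). add_mset t ts) ` ?S"
      using BA ts by (intro image_eqI[of _ _ "(B, t, ts)"]) auto
  qed
qed

section \<open>Counting trees and forests\<close>

text \<open>Grouping the subsets by size turns the sum over label sets \<open>B\<close> into the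
  binomial sum of the recurrence.\<close>

lemma sum_Pow_card:
  fixes f :: "nat \<Rightarrow> 'a :: comm_semiring_1"
  assumes "finite A"
  shows "(\<Sum>B\<in>Pow A. f (card B)) = (\<Sum>k=0..card A. of_nat (card A choose k) * f k)"
proof -
  have "(\<Sum>B\<in>Pow A. f (card B)) = (\<Sum>k=0..card A. \<Sum>B | B \<in> Pow A \<and> card B = k. f (card B))"
    using assms by (intro sum.group[symmetric]) (auto intro: card_mono)
  also have "\<dots> = (\<Sum>k=0..card A. of_nat (card A choose k) * f k)"
  proof (rule sum.cong[OF refl])
    fix k
    have "(\<Sum>B | B \<in> Pow A \<and> card B = k. f (card B)) = (\<Sum>B | B \<subseteq> A \<and> card B = k. f k)"
      by (rule sum.cong) auto
    then show "(\<Sum>B | B \<in> Pow A \<and> card B = k. f (card B)) = of_nat (card A choose k) * f k"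
      using n_subsets[OF assms] by simp
  qed
  finally show ?thesis .
qed

text \<open>The two summands belong to root blocks of size 1 and 2, with \<open>q (n + 1)\<close>
  counting the forests on \<open>n\<close> labels. Assuming the forest counts only for proper
  subsets makes the lemma usable inside the induction that proves them.\<close>

lemma trees_on_count:
  fixes q :: "nat \<Rightarrow> real"
  assumes "q 0 = 0" "finite A" "A \<noteq> {}"
    and forests: "\<And>B. B \<subset> A \<Longrightarrow> finite (forests_on B) \<and> real (card (forests_on B)) = q (card B + 1)"
  shows "finite (trees_on A) \<and> real (card (trees_on A)) = q (card A) + q (card A - 1)"
proof -
  define a where "a = Min A"
  define A' where "A' = A - {a}"
  have a: "a \<in> A" "\<And>x. x \<in> A' \<Longrightarrow> a < x"
    using assms by (auto simp: a_def A'_def order.strict_iff_order)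
  have A: "A = insert a A'" "a \<notin> A'" "finite A'" using a assms by (auto simp: A'_def)
  have inj: "inj_on (Node L) X" for L X by (auto intro: inj_onI)
  show ?thesis
  proof (cases "A' = {}")
    case True
    moreover have "finite (forests_on {}) \<and> real (card (forests_on {})) = q 1"
      using forests[of "{}"] assms(3) by auto
    ultimately show ?thesis
      \<comment> \<open>With one label there is no block of size 2; correspondingly the second
        summand is \<open>q 0 = 0\<close>.\<close>
      using assms(1) A(1) by (simp add: trees_on_singleton card_image[OF inj])
  next
    case False
    define b where "b = Min A'"
    define C where "C = A' - {b}"
    have b: "b \<in> A'" "\<And>x. x \<in> C \<Longrightarrow> b < x"
      using A False by (auto simp: b_def C_def order.strict_iff_order)
    have C: "A' = insert b C" "b \<notin> C" "finite C" using b A by (auto simp: C_def)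
    have "a < b" using a b by blast
    have eq: "trees_on A = Node {a} ` forests_on A' \<union> Node {a, b} ` forests_on C"
      using trees_on_insert2[of C a b] C \<open>a < b\<close> b A(1) by simp
    have fA': "finite (forests_on A')" "real (card (forests_on A')) = q (card A' + 1)"
      using forests[of A'] A by auto
    have fC: "finite (forests_on C)" "real (card (forests_on C)) = q (card C + 1)"
      using forests[of C] A C by auto
    have "card (trees_on A) = card (forests_on A') + card (forests_on C)"
      unfolding eq using \<open>a < b\<close> fA' fC
      by (subst card_Un_disjoint) (auto simp: card_image[OF inj])
    moreover have "card A = card A' + 1" "card A' = card C + 1" using A C by auto
    ultimately show ?thesis using fA' fC eq by simp
  qed
qed

text \<open>The recurrence matches the splitting: the tree with the fixed label and \<open>k\<close>
  others contributes \<open>q k + q (k + 1)\<close>, the remaining forest on \<open>m - k\<close>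
  labels contributes \<open>q (m - k + 1)\<close>. Finiteness is proved along with the count, since
  \<open>card\<close> is 0 on infinite sets.\<close>

lemma forests_on_count:
  fixes q :: "nat \<Rightarrow> real"
  assumes q: "q 0 = 0" "q 1 = 1"
    "\<And>m. q (m + 2) = (\<Sum>k=0..m. real (m choose k) * (q k + q (k + 1)) * q (m - k + 1))"
    and "finite A"
  shows "finite (forests_on A) \<and> real (card (forests_on A)) = q (card A + 1)"
  using \<open>finite A\<close>
proof (induction A rule: finite_psubset_induct)
  case (psubset A)
  show ?case
  proof (cases "A = {}")
    case True
    then show ?thesis using q by (simp add: forests_on_empty)
  next
    case False
    then obtain a where "a \<in> A" by auto
    define A' where "A' = A - {a}"
    have A: "A = insert a A'" "a \<notin> A'" "finite A'"
      using \<open>a \<in> A\<close> psubset.hyps by (auto simp: A'_def)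
    let ?S = "SIGMA B:Pow A'. trees_on (insert a B) \<times> forests_on (A' - B)"
    have trees: "finite (trees_on (insert a B)) \<and>
        real (card (trees_on (insert a B))) = q (card B) + q (card B + 1)" if "B \<subseteq> A'" for B
    proof -
      have fin: "finite B" "a \<notin> B" using that A finite_subset by auto
      \<comment> \<open>\<open>insert a B\<close> may be all of \<open>A\<close>, but only forests
        on its proper subsets are needed, and these are covered by the induction hypothesis.\<close>
      have "C \<subset> A" if "C \<subset> insert a B" for C using that \<open>B \<subseteq> A'\<close> A(1) by blast
      then show ?thesis
        using trees_on_count[of q "insert a B"] psubset.IH q(1) fin by simp
    qed
    have forests: "finite (forests_on (A' - B)) \<and>
        real (card (forests_on (A' - B))) = q (card A' - card B + 1)" if "B \<subseteq> A'" for B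
    proof -
      have "A' - B \<subset> A" using A by auto
      moreover have "card (A' - B) = card A' - card B"
        using that A finite_subset by (metis card_Diff_subset)
      ultimately show ?thesis using psubset.IH by metis
    qed
    note bij = forests_on_bij_betw[OF A(3,2), folded A(1)]
    have "finite ?S" using A trees forests by (intro finite_SigmaI) auto
    then have "finite (forests_on A)" using bij bij_betw_finite by blast
    moreover have "real (card (forests_on A)) = q (card A + 1)"
    proof -
      have "card (forests_on A) = card ?S" using bij_betw_same_card[OF bij] by simp
      also have "\<dots> = (\<Sum>B\<in>Pow A'. card (trees_on (insert a B)) * card (forests_on (A' - B)))"
        using A trees forests by (subst card_SigmaI) (auto simp: card_cartesian_product)
      finally have "real (card (forests_on A)) =
          (\<Sum>B\<in>Pow A'. (q (card B) + q (card B + 1)) * q (card A' - card B + 1))"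
        using trees forests by simp
      \<comment> \<open>This is the recurrence at \<open>m = card A'\<close>, where
        \<open>card A + 1 = m + 2\<close>.\<close>
      also have "\<dots> = q (card A' + 2)"
        by (subst sum_Pow_card[OF A(3)]) (simp only: q(3) of_nat_id mult.assoc)
      finally show ?thesis using A by simp
    qed
    ultimately show ?thesis by blast
  qed
qed

section \<open>The differential equation and its coefficients\<close>

text \<open>Differentiating the implicit equation by the chain rule gives
  \<open>1 = (inverse ?D oo Q) * fps_deriv Q\<close>; multiplying by \<open>?D oo Q\<close> clears
  the inverse.\<close>

lemma implicit_integral_eq_imp_deriv:
  assumes "fps_nth Q 0 = 0" "implicit_integral_eq Q"
  shows "fps_deriv Q = 2 * (fps_exp 1 oo Q) - Q - 1"
proof -
  let ?D = "2 * fps_exp 1 - fps_X - 1 :: real fps"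
  have comp: "?D oo Q = 2 * (fps_exp 1 oo Q) - Q - 1"
    using assms(1)
    by (simp add: fps_compose_sub_distrib fps_compose_mult_distrib fps_numeral_fps_const)
  have "fps_deriv fps_X = fps_deriv (fps_integral0 (inverse ?D) oo Q)"
    using assms(2) by (simp add: implicit_integral_eq_def)
  then have "1 = (inverse ?D oo Q) * fps_deriv Q"
    using assms(1) by (simp add: fps_compose_deriv fps_deriv_fps_integral)
  then have "(?D oo Q) = (?D oo Q) * (inverse ?D oo Q) * fps_deriv Q"
    by (metis mult.assoc mult.right_neutral)
  also have "(?D oo Q) * (inverse ?D oo Q) = (?D * inverse ?D) oo Q"
    using assms(1) by (simp add: fps_compose_mult_distrib)
  \<comment> \<open>\<open>?D\<close> is invertible because its constant term is 2 - 0 - 1 =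
    1.\<close>
  also have "?D * inverse ?D = 1" by (rule inverse_mult_eq_1') simp
  finally show ?thesis using comp by simp
qed

lemma egf_coeff_deriv: "egf_coeff (fps_deriv F) m = egf_coeff F (m + 1)"
  by (simp add: egf_coeff_def)

lemma egf_coeff_add: "egf_coeff (F + G) m = egf_coeff F m + egf_coeff G m"
  by (simp add: egf_coeff_def algebra_simps)

lemma egf_coeff_mult:
  "egf_coeff (F * G) m = (\<Sum>k=0..m. real (m choose k) * egf_coeff F k * egf_coeff G (m - k))"
  unfolding egf_coeff_def fps_mult_nth sum_distrib_left
  by (rule sum.cong) (auto simp: binomial_fact field_simps)

theorem theorem8p2:
  fixes Q :: "real fps"
  assumes "fps_nth Q 0 = 0"
    and "implicit_integral_eq Q"
  shows "fps_deriv tree_egf = Q + fps_deriv Q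
    \<and> (\<forall>m\<ge>1. real (num_trees m) = egf_coeff Q m + egf_coeff Q (m - 1))
    \<and> (\<forall>m. egf_coeff Q (m + 2) =
          (\<Sum>k=0..m. real (m choose k) * (egf_coeff Q k + egf_coeff Q (k + 1))
              * egf_coeff Q (m - k + 1)))
    \<and> egf_coeff Q 0 = 0 \<and> egf_coeff Q 1 = 1"
proof -
  note deriv = implicit_integral_eq_imp_deriv[OF assms]
  have "fps_deriv (fps_deriv Q) = (2 * (fps_exp 1 oo Q) - 1) * fps_deriv Q"
    by (subst deriv) (simp add: fps_compose_deriv[OF assms(1)] algebra_simps)
  \<comment> \<open>The first-order equation eliminates the exponential, leaving a product whose
    coefficients form a binomial convolution.\<close>
  also have "2 * (fps_exp 1 oo Q) - 1 = Q + fps_deriv Q" using deriv by simp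
  finally have deriv2: "fps_deriv (fps_deriv Q) = (Q + fps_deriv Q) * fps_deriv Q" .
  have q0: "egf_coeff Q 0 = 0" using assms(1) by (simp add: egf_coeff_def)
  have "egf_coeff Q 1 = fps_nth (fps_deriv Q) 0" by (simp add: egf_coeff_def)
  \<comment> \<open>\<open>fps_exp 1 oo Q\<close> has constant term 1 and \<open>Q\<close> has none,
    so the value is 2 - 0 - 1.\<close>
  also have "\<dots> = 1" using assms(1) by (subst deriv) (simp add: fps_mult_nth)
  finally have q1: "egf_coeff Q 1 = 1" .
  have rec: "egf_coeff Q (m + 2) = (\<Sum>k=0..m. real (m choose k) *
      (egf_coeff Q k + egf_coeff Q (k + 1)) * egf_coeff Q (m - k + 1))" for m
  proof -
    have "egf_coeff Q (m + 2) = egf_coeff (fps_deriv (fps_deriv Q)) m"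
      by (simp add: egf_coeff_deriv)
    then show ?thesis by (simp only: deriv2 egf_coeff_mult egf_coeff_add egf_coeff_deriv)
  qed
  have num: "real (num_trees m) = egf_coeff Q m + egf_coeff Q (m - 1)" if "m \<ge> 1" for m
  proof -
    have "finite (forests_on B) \<and> real (card (forests_on B)) = egf_coeff Q (card B + 1)"
      if "B \<subset> {1..m}" for B
      using that by (intro forests_on_count q0 q1 rec) (auto intro: finite_subset)
    then have "real (card (trees_on {1..m})) =
        egf_coeff Q (card {1..m}) + egf_coeff Q (card {1..m} - 1)"
      using trees_on_count[of "egf_coeff Q" "{1..m}"] q0 that by simp
    then show ?thesis by (simp add: num_trees_def ub_increasing_trees_def trees_on_def)
  qed
  have "fps_deriv tree_egf = Q + fps_deriv Q"
  proof (rule fps_ext)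
    fix n
    \<comment> \<open>The factor \<open>n + 1\<close> from differentiation cancels against
      \<open>fact (n + 1)\<close>; it is kept unexpanded for this.\<close>
    have "fps_nth (fps_deriv tree_egf) n = real (num_trees (n + 1)) / fact n"
      by (simp add: tree_egf_def del: of_nat_Suc)
    also have "\<dots> = (egf_coeff Q (n + 1) + egf_coeff Q n) / fact n" using num[of "n + 1"] by simp
    also have "\<dots> = fps_nth (Q + fps_deriv Q) n"
      by (simp add: egf_coeff_def field_simps)
    finally show "fps_nth (fps_deriv tree_egf) n = fps_nth (Q + fps_deriv Q) n" .
  qed
  then show ?thesis using num rec q0 q1 by blast
qed

end
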